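(* Let $d$ be a positive integer and $T=\{t_1<t_2<\dots<t_{d+1}\}$ a set of integers. Then, as multisets, $$\Omega(C_d(T))=\bigoplus_{\sigma\in S_d}\operatorname{sign}(\sigma)\,\varphi^{-1}_{t_{\sigma(1)},\dots,t_{\sigma(d)}}\bigl(R_{t_{d+1}-t_{\sigma(1)},\dots,t_{d+1}-t_{\sigma(d)}}\bigr).$$
   Context: $\nu_d(t)=(t,t^2,\dots,t^d)^T$, $C_d(T)=\mathrm{conv}\{\nu_d(t_1),\dots,\nu_d(t_{d+1})\}$. With $\pi:\mathbb{R}^d\to\mathbb{R}^{d-1}$ forgetting the last coordinate, for $y\in\pi(P)$ let $n(y,P)$ be the point of $\pi^{-1}(y)\cap P$ with smallest last coordinate; $\Omega(P)=P\setminus\bigcup_{y\in\pi(P)}n(y,P)$. For reals $r_1,\dots,r_d$, let $e_k(r_1,\dots,r_l)$ be the $k$-th elementary symmetric function ($e_0=1$), let $A_{r_1,\dots,r_d}$ be the $d\times d$ matrix with $(i,j)$ entry $(-1)^{i-j}e_{i-j}(r_1,\dots,r_i)$ for $i\ge j$ and $0$ for $i<j$, let $u_{r_1,\dots,r_d}\in\mathbb{R}^d$ have $i$-th entry $(-1)^i r_1r_2\cdots r_i$, and let $\varphi_{r_1,\dots,r_d}(x)=A_{r_1,\dots,r_d}x+u_{r_1,\dots,r_d}$ (an invertible affine map). For positive integers $s_1,\dots,s_d$, with $x_0=1$, let $P_{s_1,\dots,s_d}=\{x\in\mathbb{R}^d: 0\le x_i\le s_ix_{i-1},\ i=1,\dots,d\}$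 and $R_{s_1,\dots,s_d}=\Omega(P_{s_1,\dots,s_d})$ ($=P_{s_1,\dots,s_d}\cap\{x_d>0\}$). Sets are regarded as multisets with integer (possibly negative) multiplicities; $\oplus$ adds multiplicities, and multiplying by $\operatorname{sign}(\sigma)\in\{\pm1\}$ multiplies the multiplicities. *)

theory Defs
  imports
    "Jordan_Normal_Form.Matrix"
    "HOL-Combinatorics.Permutations"
    "HOL-Library.Indicator_Function"
begin

text \<open>
  Points of \<open>\<real>\<^sup>d\<close> are the elements of \<^term>\<open>carrier_vec d :: real vec set\<close>. All indices start at 0:
  the coordinate \<open>x $ i\<close> and the parameters \<open>r i\<close>, \<open>s i\<close>, \<open>t i\<close> below are usually written
  \<open>x\<^sub>i\<^sub>+\<^sub>1\<close>, \<open>r\<^sub>i\<^sub>+\<^sub>1\<close>, \<open>s\<^sub>i\<^sub>+\<^sub>1\<close>, \<open>t\<^sub>i\<^sub>+\<^sub>1\<close>, so the last coordinate of \<open>x\<close> is \<open>x $ (d - 1)\<close>.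
\<close>

definition moment_curve :: "nat \<Rightarrow> real \<Rightarrow> real vec" where
  "moment_curve d t = vec d (\<lambda>i. t ^ Suc i)"

text \<open>
  The type \<^typ>\<open>real vec\<close> contains vectors of all dimensions and is not a real vector space, so
  convex hulls are written out as the set of all finite convex combinations.
\<close>

definition conv :: "nat \<Rightarrow> real vec set \<Rightarrow> real vec set" where
  "conv d V = {vec d (\<lambda>i. \<Sum>v\<in>F. c v * v $ i) | F c.
     finite F \<and> F \<subseteq> V \<and> (\<forall>v\<in>F. 0 \<le> c v) \<and> sum c F = 1}"

definition cyclic_polytope :: "nat \<Rightarrow> real set \<Rightarrow> real vec set" where
  "cyclic_polytope d T = conv d (moment_curve d ` T)"

definition forget_last :: "nat \<Rightarrow> real vec \<Rightarrow> real vec" where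
  "forget_last d x = vec_first x (d - 1)"

definition lowest_point :: "nat \<Rightarrow> real vec \<Rightarrow> real vec set \<Rightarrow> real vec" where
  "lowest_point d y P = arg_min (\<lambda>x. x $ (d - 1)) (\<lambda>x. x \<in> P \<and> forget_last d x = y)"

definition Omega :: "nat \<Rightarrow> real vec set \<Rightarrow> real vec set" where
  "Omega d P = P - (\<Union>y \<in> forget_last d ` P. {lowest_point d y P})"

text \<open>\<open>elem_sym k r l\<close> is \<open>e\<^sub>k\<close> of the \<open>l\<close> numbers \<open>r 0, \<dots>, r (l - 1)\<close>.\<close>

definition elem_sym :: "nat \<Rightarrow> (nat \<Rightarrow> real) \<Rightarrow> nat \<Rightarrow> real" where
  "elem_sym k r l = (\<Sum>S | S \<subseteq> {..<l} \<and> card S = k. \<Prod>i\<in>S. r i)"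

definition A_mat :: "nat \<Rightarrow> (nat \<Rightarrow> real) \<Rightarrow> real mat" where
  "A_mat d r = mat d d (\<lambda>(i, j).
     if j \<le> i then (-1) ^ (i - j) * elem_sym (i - j) r (Suc i) else 0)"

definition u_vec :: "nat \<Rightarrow> (nat \<Rightarrow> real) \<Rightarrow> real vec" where
  "u_vec d r = vec d (\<lambda>i. (-1) ^ Suc i * (\<Prod>k\<le>i. r k))"

definition phi :: "nat \<Rightarrow> (nat \<Rightarrow> real) \<Rightarrow> real vec \<Rightarrow> real vec" where
  "phi d r x = A_mat d r *\<^sub>v x + u_vec d r"

definition phi_inv :: "nat \<Rightarrow> (nat \<Rightarrow> real) \<Rightarrow> real vec \<Rightarrow> real vec" where
  "phi_inv d r = inv_into (carrier_vec d) (phi d r)"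

definition P_set :: "nat \<Rightarrow> (nat \<Rightarrow> int) \<Rightarrow> real vec set" where
  "P_set d s = {x \<in> carrier_vec d. \<forall>i<d.
     0 \<le> x $ i \<and> x $ i \<le> of_int (s i) * (if i = 0 then 1 else x $ (i - 1))}"

definition R_set :: "nat \<Rightarrow> (nat \<Rightarrow> int) \<Rightarrow> real vec set" where
  "R_set d s = Omega d (P_set d s)"

text \<open>
  A multiset with integer multiplicities is its multiplicity function \<^typ>\<open>real vec \<Rightarrow> int\<close>; a set is
  the multiset given by its indicator function, and multisets are added and scaled pointwise.
\<close>

abbreviation set_as_mset :: "real vec set \<Rightarrow> real vec \<Rightarrow> int" where
  "set_as_mset \<equiv> indicator"

end

theory Submission
  imports Defs "Jordan_Normal_Form.Determinant"
begin

text \<open>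
  Write a point \<open>x\<close> as the affine combination of the points of the moment curve at
  \<open>t 0, \<dots>, t d\<close> with weights \<open>w 0, \<dots>, w d\<close>. Then \<open>\<phi>\<^sub>r(x)\<^sub>i = \<Sum>\<^sub>j w j \<Prod>\<^sub>k\<^sub>\<le>\<^sub>i (t j - r k)\<close>.
  Moving \<open>x\<close> along the last axis changes the weights at rates of alternating sign, so \<open>x\<close> lies in
  \<open>\<Omega>(C\<^sub>d(T))\<close> iff all weights are nonnegative and \<open>w d, w (d - 2), \<dots>\<close> are positive.
  On the other side, with \<open>v j = w j (t d - t j)\<close>, the term of \<open>\<sigma>\<close> contains \<open>x\<close> iff \<open>w d > 0\<close> and
  \<open>\<Sum>\<^sub>j v j \<Prod>\<^sub>k\<^sub><\<^sub>i (t j - t (\<sigma> k)) \<ge> 0\<close> for all \<open>i < d\<close>. The signed count of such \<open>\<sigma>\<close> is computed by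
  induction on \<open>d\<close>: fixing \<open>\<sigma> 0 = a\<close> leaves the same problem for the other points with \<open>v j\<close>
  replaced by \<open>v j (t j - t a)\<close>, which reverses precisely the sign conditions at \<open>j < a\<close>, and the
  alternating sum over \<open>a\<close> telescopes.
\<close>

section \<open>Signed count of the permutations that satisfy a flag of sign conditions\<close>

text \<open>Let p(a) say that \<open>g\<close> fails below \<open>a\<close> and holds from
  \<open>a\<close> to \<open>n\<close>. The term of \<open>a\<close> leaves \<open>g a\<close> free,
  so its indicator is that of p(a) plus that of p(a+1), and the alternating sum telescopes to its
  two ends.\<close>

lemma alternating_sum_split:
  fixes g :: "nat \<Rightarrow> bool"
  shows "(\<Sum>a\<le>n. (-1) ^ a * of_bool ((\<forall>j<a. \<not> g j) \<and> (\<forall>j. a < j \<and> j \<le> n \<longrightarrow> g j))) =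
    (of_bool (\<forall>j\<le>n. g j) + (-1) ^ n * of_bool (\<forall>j\<le>n. \<not> g j) :: int)"
proof (induction n)
  case 0
  then show ?case by auto
next
  case (Suc n)
  show ?case
  proof (cases "g (Suc n)")
    case True
    have "(\<Sum>a\<le>n. (-1) ^ a * of_bool ((\<forall>j<a. \<not> g j) \<and> (\<forall>j. a < j \<and> j \<le> Suc n \<longrightarrow> g j)) :: int) =
      (\<Sum>a\<le>n. (-1) ^ a * of_bool ((\<forall>j<a. \<not> g j) \<and> (\<forall>j. a < j \<and> j \<le> n \<longrightarrow> g j)))"
      using True by (intro sum.cong refl arg_cong2[where f = "(*)"]) (auto simp: le_Suc_eq)
    with Suc True show ?thesis by (auto simp: le_Suc_eq less_Suc_eq_le)
  next
    case False
    have "(\<Sum>a\<le>n. (-1) ^ a * of_bool ((\<forall>j<a. \<not> g j) \<and> (\<forall>j. a < j \<and> j \<le> Suc n \<longrightarrow> g j)) :: int) = 0"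
      using False by (intro sum.neutral) auto
    with False show ?thesis by (auto simp: le_Suc_eq less_Suc_eq_le)
  qed
qed

text \<open>Group the permutations by their value \<open>a\<close> at 0. Deleting this entry leaves
  a permutation of \<open>n\<close> points and changes the sign by \<open>(-1) ^ a\<close>.\<close>

lemma sum_permutes_Suc:
  fixes f :: "(nat \<Rightarrow> nat) \<Rightarrow> int"
  shows "(\<Sum>\<sigma> | \<sigma> permutes {..<Suc n}. sign \<sigma> * f \<sigma>) =
    (\<Sum>a\<le>n. (-1) ^ a * (\<Sum>\<tau> | \<tau> permutes {..<n}. sign \<tau> * f (permutation_insert 0 a \<tau>)))"
proof -
  have "(\<Sum>\<sigma> | \<sigma> permutes {..<Suc n}. sign \<sigma> * f \<sigma>) =
    (\<Sum>a\<le>n. \<Sum>\<sigma> | \<sigma> \<in> {\<sigma>. \<sigma> permutes {..<Suc n}} \<and> \<sigma> 0 = a. sign \<sigma> * f \<sigma>)"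
    by (rule sum.group[symmetric])
      (auto simp: finite_permutations simp flip: lessThan_Suc_atMost dest: permutes_in_image[where x = 0])
  also have "\<dots> = (\<Sum>a\<le>n. \<Sum>\<tau> | \<tau> permutes {..<n}.
      sign (permutation_insert 0 a \<tau>) * f (permutation_insert 0 a \<tau>))"
  proof (rule sum.cong[OF refl])
    fix a assume "a \<in> {..n}"
    then have "a < Suc n" by simp
    note fix_a = permutation_fix[OF zero_less_Suc this] permutation_insert_inj_on[OF zero_less_Suc this]
    show "(\<Sum>\<sigma> | \<sigma> \<in> {\<sigma>. \<sigma> permutes {..<Suc n}} \<and> \<sigma> 0 = a. sign \<sigma> * f \<sigma>) =
      (\<Sum>\<tau> | \<tau> permutes {..<n}. sign (permutation_insert 0 a \<tau>) * f (permutation_insert 0 a \<tau>))"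
      using fix_a by (simp add: sum.reindex lessThan_atLeast0)
  qed
  also have "\<dots> = (\<Sum>a\<le>n. (-1) ^ a * (\<Sum>\<tau> | \<tau> permutes {..<n}. sign \<tau> * f (permutation_insert 0 a \<tau>)))"
    unfolding sum_distrib_left
    by (intro sum.cong refl)
      (use signof_permutation_insert[where 'a = int and i = 0] in \<open>auto simp: lessThan_atLeast0 mult.assoc\<close>)
  finally show ?thesis .
qed

text \<open>For \<open>n = d\<close> and \<open>v j = w j * (t d - t j)\<close> the sums are the
  slacks in the upper bounds of \<open>P_set\<close> at the image of the point under
  \<open>phi\<close>.\<close>

definition flag_nonneg :: "nat \<Rightarrow> (nat \<Rightarrow> real) \<Rightarrow> (nat \<Rightarrow> real) \<Rightarrow> (nat \<Rightarrow> nat) \<Rightarrow> bool" where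
  "flag_nonneg n t v \<sigma> \<longleftrightarrow> (\<forall>i<n. 0 \<le> (\<Sum>j<n. v j * (\<Prod>k<i. t j - t (\<sigma> k))))"

text \<open>The condition at \<open>i = 0\<close> is the one on \<open>sum v {..n}\<close>. In all
  later sums the factor of \<open>k = 0\<close> is \<open>t j - t a\<close>: it removes the index
  \<open>a\<close> and is absorbed into \<open>v\<close>. The map \<open>insert_index a\<close>
  enumerates the remaining indices.\<close>

lemma flag_nonneg_permutation_insert:
  assumes "a \<le> n"
  shows "flag_nonneg (Suc n) t v (permutation_insert 0 a \<tau>) \<longleftrightarrow> 0 \<le> sum v {..n} \<and>
    flag_nonneg n (t \<circ> insert_index a) (\<lambda>j. v (insert_index a j) * (t (insert_index a j) - t a)) \<tau>"
proof -
  let ?I = "insert_index a"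
  have ins: "permutation_insert 0 a \<tau> (Suc k) = ?I (\<tau> k)" for k
    by (simp add: permutation_insert_def insert_dom_def insert_ran_def delete_index_def)
  have "(\<Sum>j<Suc n. v j * (\<Prod>k<Suc i. t j - t (permutation_insert 0 a \<tau> k))) =
      (\<Sum>j<n. v (?I j) * (t (?I j) - t a) * (\<Prod>k<i. t (?I j) - t (?I (\<tau> k))))" for i
  proof -
    have img: "{..<Suc n} - {a} = ?I ` {..<n}"
      using insert_index_image[of a n] assms by (simp add: lessThan_atLeast0)
    have "(\<Sum>j<Suc n. v j * (\<Prod>k<Suc i. t j - t (permutation_insert 0 a \<tau> k))) =
      (\<Sum>j<Suc n. v j * (t j - t a) * (\<Prod>k<i. t j - t (?I (\<tau> k))))"
      by (simp only: prod.lessThan_Suc_shift ins permutation_insert_inserted mult.assoc)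
    also have "\<dots> = (\<Sum>j\<in>{..<Suc n} - {a}. v j * (t j - t a) * (\<Prod>k<i. t j - t (?I (\<tau> k))))"
      by (rule sum.mono_neutral_right) auto
    also have "\<dots> = (\<Sum>j<n. v (?I j) * (t (?I j) - t a) * (\<Prod>k<i. t (?I j) - t (?I (\<tau> k))))"
      unfolding img by (subst sum.reindex) (auto simp: inj_on_def insert_index_def split: if_splits)
    finally show ?thesis .
  qed
  then show ?thesis
    unfolding flag_nonneg_def All_less_Suc2 o_def by (simp add: lessThan_Suc_atMost)
qed

text \<open>Going down from \<open>j = n - 1\<close>, weak and strict inequalities alternate,
  starting with a weak one. The negation of either kind for \<open>v\<close> is the other kind for
  \<open>-v\<close>, which is what the induction on \<open>n\<close> needs.\<close>

definition alt_nonneg :: "nat \<Rightarrow> nat \<Rightarrow> real \<Rightarrow> bool" where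
  "alt_nonneg n j v \<longleftrightarrow> (if odd (n + j) then 0 \<le> v else 0 < v)"

lemma sum_sign_flag_nonneg:
  assumes "strict_mono_on {..<n} t"
  shows "(\<Sum>\<sigma> | \<sigma> permutes {..<n}. sign \<sigma> * of_bool (flag_nonneg n t v \<sigma>)) =
    (of_bool (\<forall>j<n. alt_nonneg n j (v j)) :: int)"
  using assms
proof (induction n arbitrary: t v)
  case 0
  then show ?case by (simp add: flag_nonneg_def)
next
  case (Suc n)
  let ?w = "\<lambda>a j. v (insert_index a j) * (t (insert_index a j) - t a)"
  let ?g = "\<lambda>j. alt_nonneg (Suc n) j (v j)"
  have good: "(\<forall>j<n. alt_nonneg n j (?w a j)) \<longleftrightarrow> (\<forall>j<a. \<not> ?g j) \<and> (\<forall>j. a < j \<and> j \<le> n \<longrightarrow> ?g j)"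
    if a: "a \<le> n" for a
  proof -
    \<comment> \<open>Here \<open>n\<close> drops by one while \<open>j\<close> stays, so weak and
      strict are exchanged; the factor is negative, and together this negates the condition.\<close>
    have lo: "alt_nonneg n j (?w a j) \<longleftrightarrow> \<not> ?g j" if "j < a" for j
    proof -
      have "t j - t a < 0"
        using strict_mono_onD[OF Suc.prems, of j a] that a by simp
      then show ?thesis using that
        by (auto simp: insert_index_def alt_nonneg_def mult_less_0_iff zero_le_mult_iff zero_less_mult_iff)
    qed
    \<comment> \<open>Here \<open>n\<close> and the index both drop by one, so the parity is kept;
      the factor is positive and the condition persists.\<close>
    have hi: "alt_nonneg n j (?w a j) \<longleftrightarrow> ?g (Suc j)" if "a \<le> j" "j < n" for j
    proof -
      have "t (Suc j) - t a > 0"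
        using strict_mono_onD[OF Suc.prems, of a "Suc j"] that a by simp
      then show ?thesis using that
        by (auto simp: insert_index_def alt_nonneg_def zero_le_mult_iff zero_less_mult_iff)
    qed
    show ?thesis (is "?L \<longleftrightarrow> ?R")
    proof
      assume L: ?L
      show ?R
      proof (intro conjI allI impI)
        fix j assume "j < a" then show "\<not> ?g j" using L lo[of j] a by (metis less_le_trans)
      next
        fix j assume "a < j \<and> j \<le> n"
        then have "a \<le> j - 1" "j - 1 < n" "Suc (j - 1) = j" by auto
        then show "?g j" using L hi[of "j - 1"] by metis
      qed
    next
      assume ?R
      then show ?L using lo hi by (metis Suc_leI le_imp_less_Suc not_le)
    qed
  qed
  have mono: "strict_mono_on {..<n} (t \<circ> insert_index a)" if "a \<le> n" for a
    using strict_mono_onD[OF Suc.prems] by (intro strict_mono_onI) (auto simp: insert_index_def)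
  have IH: "(\<Sum>\<tau> | \<tau> permutes {..<n}. sign \<tau> * of_bool (flag_nonneg (Suc n) t v (permutation_insert 0 a \<tau>))) =
     of_bool (0 \<le> sum v {..n}) * (of_bool ((\<forall>j<a. \<not> ?g j) \<and> (\<forall>j. a < j \<and> j \<le> n \<longrightarrow> ?g j)) :: int)"
    if a: "a \<le> n" for a
    unfolding good[OF a, symmetric] Suc.IH[OF mono[OF a], of "?w a", symmetric] 
    by (simp add: flag_nonneg_permutation_insert[OF a])
  have "(\<Sum>\<sigma> | \<sigma> permutes {..<Suc n}. sign \<sigma> * of_bool (flag_nonneg (Suc n) t v \<sigma>)) =
    of_bool (0 \<le> sum v {..n}) *
    (\<Sum>a\<le>n. (-1) ^ a * (of_bool ((\<forall>j<a. \<not> ?g j) \<and> (\<forall>j. a < j \<and> j \<le> n \<longrightarrow> ?g j)) :: int))"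
    unfolding sum_permutes_Suc sum_distrib_left[of _ _ "{..n}"]
    by (intro sum.cong refl) (simp only: IH atMost_iff, rule mult.left_commute)
  also have "\<dots> = of_bool (0 \<le> sum v {..n}) *
      (of_bool (\<forall>j\<le>n. ?g j) + (-1) ^ n * of_bool (\<forall>j\<le>n. \<not> ?g j))"
    by (simp only: alternating_sum_split)
  \<comment> \<open>The factor \<open>0 \<le> sum v {..n}\<close> is implied when all conditions
    hold. When all fail, every \<open>v j\<close> is nonpositive and \<open>v n\<close> is negative,
    so the factor removes this second end of the telescope.\<close>
  also have "\<dots> = of_bool (\<forall>j\<le>n. ?g j)"
  proof -
    have "0 \<le> sum v {..n}" if "\<forall>j\<le>n. ?g j"
      using that by (intro sum_nonneg) (force simp: alt_nonneg_def split: if_splits)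
    moreover have "sum v {..n} < 0" if "\<forall>j\<le>n. \<not> ?g j"
    proof -
      have "sum v {..n} < (\<Sum>j\<le>n. 0)"
      proof (rule sum_strict_mono_ex1)
        show "\<forall>j\<in>{..n}. v j \<le> 0"
        proof
          fix j assume "j \<in> {..n}"
          then have "\<not> ?g j" using that by simp
          then show "v j \<le> 0" by (simp add: alt_nonneg_def split: if_splits)
        qed
        show "\<exists>j\<in>{..n}. v j < 0"
          using that by (intro bexI[of _ n]) (auto simp: alt_nonneg_def)
      qed simp
      then show ?thesis by simp
    qed
    ultimately show ?thesis by (cases "\<forall>j\<le>n. \<not> ?g j"; cases "\<forall>j\<le>n. ?g j") auto
  qed
  finally show ?case by (simp add: less_Suc_eq_le)
qed

section \<open>Vieta's formula, Lagrange interpolation and barycentric coordinates\<close>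

text \<open>Expand over the set \<open>X\<close> of factors that contribute \<open>- r k\<close> and
  group by its cardinality. For \<open>l = Suc i\<close> the coefficients are row \<open>i\<close>
  of \<open>A_mat\<close> preceded by entry \<open>i\<close> of \<open>u_vec\<close>.\<close>

lemma prod_diff_elem_sym:
  "(\<Prod>k<l. z - r k) = (\<Sum>m\<le>l. (-1) ^ (l - m) * elem_sym (l - m) r l * z ^ m)"
proof -
  have "(\<Prod>k<l. z - r k) = (\<Prod>k<l. - r k + z)"
    by (intro prod.cong) auto
  also have "\<dots> = (\<Sum>X\<in>Pow {..<l}. (\<Prod>k\<in>X. - r k) * (\<Prod>k\<in>{..<l} - X. z))"
    by (rule prod_add) simp
  also have "\<dots> = (\<Sum>X\<in>Pow {..<l}. (-1) ^ card X * (\<Prod>k\<in>X. r k) * z ^ (l - card X))"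
    by (intro sum.cong refl)
      (auto simp: card_Diff_subset finite_subset prod_uminus)
  also have "\<dots> = (\<Sum>c\<le>l. \<Sum>X | X \<in> Pow {..<l} \<and> card X = c. (-1) ^ card X * (\<Prod>k\<in>X. r k) * z ^ (l - card X))"
    by (rule sum.group[symmetric]) (auto dest: card_mono[OF finite_lessThan])
  also have "\<dots> = (\<Sum>c\<le>l. (-1) ^ c * elem_sym c r l * z ^ (l - c))"
    unfolding elem_sym_def sum_distrib_left sum_distrib_right
    by (intro sum.cong refl) auto
  also have "\<dots> = (\<Sum>m\<le>l. (-1) ^ (l - m) * elem_sym (l - m) r l * z ^ m)"
    by (rule sum.reindex_bij_witness[of _ "\<lambda>m. l - m" "\<lambda>m. l - m"]) auto
  finally show ?thesis .
qed

definition lagrange_basis :: "nat \<Rightarrow> (nat \<Rightarrow> real) \<Rightarrow> nat \<Rightarrow> real poly" where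
  "lagrange_basis d t i = smult (inverse (\<Prod>k\<in>{..d} - {i}. t i - t k)) (\<Prod>k\<in>{..d} - {i}. [:- t k, 1:])"

lemma degree_lagrange_basis: "i \<le> d \<Longrightarrow> degree (lagrange_basis d t i) \<le> d"
  unfolding lagrange_basis_def
  by (rule order_trans[OF degree_smult_le]) (simp add: degree_prod_sum_eq)

lemma coeff_lagrange_basis:
  assumes "i \<le> d"
  shows "coeff (lagrange_basis d t i) d = inverse (\<Prod>k\<in>{..d} - {i}. t i - t k)"
proof -
  let ?p = "\<Prod>k\<in>{..d} - {i}. [:- t k, 1:]"
  have "degree ?p = d" using assms by (simp add: degree_prod_sum_eq)
  moreover have "lead_coeff ?p = 1" by (simp add: lead_coeff_prod)
  ultimately show ?thesis by (simp add: lagrange_basis_def)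
qed

lemma poly_lagrange_basis:
  assumes "inj_on t {..d}" "i \<le> d" "j \<le> d"
  shows "poly (lagrange_basis d t i) (t j) = of_bool (i = j)"
proof (cases "i = j")
  case True
  have "(\<Prod>k\<in>{..d} - {i}. t i - t k) \<noteq> 0"
    using assms by (auto simp: inj_on_def)
  with True show ?thesis by (simp add: lagrange_basis_def poly_prod)
next
  case False
  then have "(\<Prod>k\<in>{..d} - {i}. t j - t k) = 0"
    using assms by (intro prod_zero) auto
  with False show ?thesis by (simp add: lagrange_basis_def poly_prod)
qed

text \<open>The coordinates of \<open>x\<close> in the indexing of the paper, with \<open>x\<^sub>0 = 1\<close>.\<close>

definition homog :: "real vec \<Rightarrow> nat \<Rightarrow> real" where
  "homog x m = (if m = 0 then 1 else x $ (m - 1))"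

text \<open>
  Barycentric coordinates: the functional sending the monomial of degree \<open>m\<close> to \<open>x\<^sub>m\<close>, applied to
  the Lagrange basis polynomials.
\<close>

definition weight :: "nat \<Rightarrow> (nat \<Rightarrow> real) \<Rightarrow> real vec \<Rightarrow> nat \<Rightarrow> real" where
  "weight d t x i = (\<Sum>m\<le>d. coeff (lagrange_basis d t i) m * homog x m)"

text \<open>By linearity the functional defining \<open>weight\<close> evaluates to the
  \<open>w\<close>-weighted sum of the values of the \<open>i\<close>-th basis polynomial at the
  nodes, and only the node \<open>t i\<close> contributes.\<close>

lemma weight_unique:
  assumes "inj_on t {..d}" "i \<le> d" and x: "\<And>m. m \<le> d \<Longrightarrow> homog x m = (\<Sum>j\<le>d. w j * t j ^ m)"
  shows "weight d t x i = w i"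
proof -
  let ?p = "lagrange_basis d t i"
  have p: "(\<Sum>m\<le>d. coeff ?p m * y ^ m) = poly ?p y" for y
  proof -
    have "poly ?p y = poly (\<Sum>m\<le>d. monom (coeff ?p m) m) y"
      by (simp only: poly_as_sum_of_monoms'[OF degree_lagrange_basis[OF \<open>i \<le> d\<close>]])
    then show ?thesis by (simp add: poly_sum poly_monom)
  qed
  have "weight d t x i = (\<Sum>m\<le>d. \<Sum>j\<le>d. coeff ?p m * (w j * t j ^ m))"
    by (simp add: weight_def x sum_distrib_left)
  also have "\<dots> = (\<Sum>j\<le>d. \<Sum>m\<le>d. coeff ?p m * (w j * t j ^ m))"
    by (rule sum.swap)
  also have "\<dots> = (\<Sum>j\<le>d. w j * poly ?p (t j))"
    by (simp add: sum_distrib_left mult_ac flip: p)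
  also have "\<dots> = (\<Sum>j\<le>d. if j = i then w j else 0)"
    using assms(1,2) by (intro sum.cong refl) (auto simp: poly_lagrange_basis)
  finally show ?thesis using assms(2) by simp
qed

text \<open>Interpolation at \<open>d + 1\<close> nodes reproduces every monomial of degree at most
  \<open>d\<close>; apply the functional to this polynomial identity.\<close>

lemma sum_weight_power:
  assumes "inj_on t {..d}" "m \<le> d"
  shows "(\<Sum>j\<le>d. weight d t x j * t j ^ m) = homog x m"
proof -
  let ?L = "\<lambda>j. lagrange_basis d t j"
  have "(\<Sum>j\<le>d. smult (t j ^ m) (?L j)) = monom 1 m"
  proof (rule poly_eqI_degree[of "t ` {..d}"])
    fix y assume "y \<in> t ` {..d}"
    then obtain i where i: "i \<le> d" "y = t i" by auto
    have "poly (\<Sum>j\<le>d. smult (t j ^ m) (?L j)) y = (\<Sum>j\<le>d. if j = i then t j ^ m else 0)"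
      unfolding poly_sum using assms(1) i by (intro sum.cong refl) (auto simp: poly_lagrange_basis)
    then show "poly (\<Sum>j\<le>d. smult (t j ^ m) (?L j)) y = poly (monom 1 m) y"
      using i by (simp add: poly_monom)
  next
    have "degree (\<Sum>j\<le>d. smult (t j ^ m) (?L j)) \<le> d"
      by (intro degree_sum_le order_trans[OF degree_smult_le] degree_lagrange_basis) auto
    then show "degree (\<Sum>j\<le>d. smult (t j ^ m) (?L j)) < card (t ` {..d})"
      using assms(1) by (simp add: card_image)
  qed (use assms in \<open>simp add: card_image degree_monom_eq\<close>)
  from arg_cong[OF this, of coeff]
  have c: "(\<Sum>j\<le>d. t j ^ m * coeff (?L j) k) = of_bool (m = k)" for k
    by (simp add: coeff_sum fun_eq_iff)
  have "(\<Sum>j\<le>d. weight d t x j * t j ^ m) = (\<Sum>j\<le>d. \<Sum>k\<le>d. t j ^ m * coeff (?L j) k * homog x k)"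
    unfolding weight_def sum_distrib_right by (simp add: mult_ac)
  also have "\<dots> = (\<Sum>k\<le>d. \<Sum>j\<le>d. t j ^ m * coeff (?L j) k * homog x k)"
    by (rule sum.swap)
  also have "\<dots> = (\<Sum>k\<le>d. if k = m then homog x k else 0)"
    unfolding sum_distrib_right[symmetric] c by (intro sum.cong refl) auto
  finally show ?thesis using assms(2) by simp
qed

section \<open>The affine map and its inverse\<close>

lemma phi_carrier: "phi d r x \<in> carrier_vec d"
  by (rule carrier_vecI) (simp add: phi_def u_vec_def)

text \<open>The translation part becomes the summand \<open>m = 0\<close>, because the top
  elementary symmetric function is the full product and \<open>homog x 0 = 1\<close>.\<close>

lemma phi_index_homog:
  assumes "x \<in> carrier_vec d" "i < d"
  shows "phi d r x $ i = (\<Sum>m\<le>Suc i. (-1) ^ (Suc i - m) * elem_sym (Suc i - m) r (Suc i) * homog x m)"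
proof -
  let ?a = "\<lambda>j. (-1) ^ (i - j) * elem_sym (i - j) r (Suc i)"
  have "{S. S \<subseteq> {..<Suc i} \<and> card S = Suc i} = {{..<Suc i}}"
    using card_subset_eq[OF finite_lessThan, of _ "Suc i"] by auto
  then have e: "elem_sym (Suc i) r (Suc i) = (\<Prod>k\<le>i. r k)"
    by (simp add: elem_sym_def flip: lessThan_Suc_atMost)
  have "phi d r x $ i = (\<Sum>j<d. (if j \<le> i then ?a j else 0) * x $ j) + (-1) ^ Suc i * (\<Prod>k\<le>i. r k)"
    using assms by (simp add: phi_def A_mat_def u_vec_def scalar_prod_def lessThan_atLeast0)
  also have "(\<Sum>j<d. (if j \<le> i then ?a j else 0) * x $ j) = (\<Sum>j\<le>i. ?a j * x $ j)"
    using assms by (intro sum.mono_neutral_cong_right) auto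
  finally show ?thesis
    unfolding sum.atMost_Suc_shift[of _ i] by (simp add: e homog_def)
qed

text \<open>By Vieta's formula, coordinate \<open>i\<close> is the functional of the point applied
  to the polynomial with roots \<open>r 0, \<dots>, r i\<close>.\<close>

lemma phi_index_weight:
  assumes "inj_on t {..d}" "x \<in> carrier_vec d" "i < d"
  shows "phi d r x $ i = (\<Sum>j\<le>d. weight d t x j * (\<Prod>k<Suc i. t j - r k))"
proof -
  let ?a = "\<lambda>m. (-1) ^ (Suc i - m) * elem_sym (Suc i - m) r (Suc i)"
  have "phi d r x $ i = (\<Sum>m\<le>Suc i. \<Sum>j\<le>d. ?a m * (weight d t x j * t j ^ m))"
    unfolding phi_index_homog[OF assms(2,3)] using assms
    by (intro sum.cong refl) (auto simp: sum_weight_power simp flip: sum_distrib_left)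
  also have "\<dots> = (\<Sum>j\<le>d. \<Sum>m\<le>Suc i. ?a m * (weight d t x j * t j ^ m))"
    by (rule sum.swap)
  also have "\<dots> = (\<Sum>j\<le>d. weight d t x j * (\<Prod>k<Suc i. t j - r k))"
    unfolding prod_diff_elem_sym sum_distrib_left by (intro sum.cong refl) (simp add: mult_ac)
  finally show ?thesis .
qed

lemma bij_betw_phi: "bij_betw (phi d r) (carrier_vec d) (carrier_vec d)"
proof -
  let ?A = "A_mat d r" and ?u = "u_vec d r"
  have A: "?A \<in> carrier_mat d d" and u: "?u \<in> carrier_vec d"
    by (auto simp: A_mat_def u_vec_def)
  \<comment> \<open>This makes \<open>elem_sym 0\<close> equal to 1, so \<open>A_mat\<close> is
    unitriangular and has determinant 1.\<close>
  have S: "{S. S \<subseteq> {..<l} \<and> card S = 0} = {{}}" for l :: nat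
    by (auto dest: finite_subset)
  have "diag_mat ?A = replicate d 1"
    by (rule nth_equalityI) (auto simp: A_mat_def diag_mat_def elem_sym_def S)
  moreover have "det ?A = prod_list (diag_mat ?A)"
    by (rule det_lower_triangular[OF _ A]) (auto simp: A_mat_def)
  ultimately have "det ?A \<noteq> 0" by (simp add: prod_list_replicate)
  from det_non_zero_imp_unit[OF A this, of "()"]
  obtain B where B: "B \<in> carrier_mat d d" "B * ?A = 1\<^sub>m d" "?A * B = 1\<^sub>m d"
    unfolding Units_def ring_mat_def by auto
  show ?thesis
  proof (rule bij_betw_byWitness[where f' = "\<lambda>y. B *\<^sub>v (y - ?u)"])
    show "\<forall>x\<in>carrier_vec d. B *\<^sub>v (phi d r x - ?u) = x"
    proof
      fix x :: "real vec" assume x: "x \<in> carrier_vec d"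
      have "phi d r x - ?u = ?A *\<^sub>v x"
        using A u x by (intro eq_vecI) (auto simp: phi_def)
      then show "B *\<^sub>v (phi d r x - ?u) = x"
        using A B x by (simp flip: assoc_mult_mat_vec)
    qed
    show "\<forall>y\<in>carrier_vec d. phi d r (B *\<^sub>v (y - ?u)) = y"
    proof
      fix y :: "real vec" assume y: "y \<in> carrier_vec d"
      have "?A *\<^sub>v (B *\<^sub>v (y - ?u)) = y - ?u"
        using A B y u by (simp flip: assoc_mult_mat_vec)
      then show "phi d r (B *\<^sub>v (y - ?u)) = y"
        using u y unfolding phi_def by (intro eq_vecI) auto
    qed
    show "phi d r ` carrier_vec d \<subseteq> carrier_vec d" by (auto simp: phi_carrier)
    show "(\<lambda>y. B *\<^sub>v (y - ?u)) ` carrier_vec d \<subseteq> carrier_vec d" using B u by auto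
  qed
qed

lemma mem_phi_inv_image_iff:
  assumes "R \<subseteq> carrier_vec d"
  shows "x \<in> phi_inv d r ` R \<longleftrightarrow> x \<in> carrier_vec d \<and> phi d r x \<in> R"
proof -
  note b = bij_betw_phi[of d r]
  show ?thesis unfolding phi_inv_def
  proof
    assume "x \<in> inv_into (carrier_vec d) (phi d r) ` R"
    then obtain y where y: "y \<in> R" "x = inv_into (carrier_vec d) (phi d r) y" by auto
    moreover have "x \<in> carrier_vec d"
      using y assms bij_betw_apply[OF bij_betw_inv_into[OF b]] by auto
    ultimately show "x \<in> carrier_vec d \<and> phi d r x \<in> R"
      using assms bij_betw_inv_into_right[OF b, of y] by auto
  next
    assume x: "x \<in> carrier_vec d \<and> phi d r x \<in> R"
    then have "x = inv_into (carrier_vec d) (phi d r) (phi d r x)"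
      using bij_betw_inv_into_left[OF b, of x] by simp
    with x show "x \<in> inv_into (carrier_vec d) (phi d r) ` R" by blast
  qed
qed

section \<open>Removing the lowest points, in general and for \<open>P_set\<close>\<close>

lemma forget_last_eq_iff: "forget_last d x = forget_last d z \<longleftrightarrow> (\<forall>i<d - 1. x $ i = z $ i)"
  by (auto simp: forget_last_def vec_first_def vec_eq_iff)

lemma vec_eq_forget_last:
  assumes "x \<in> carrier_vec d" "z \<in> carrier_vec d" "forget_last d x = forget_last d z" "x $ (d - 1) = z $ (d - 1)"
  shows "x = z"
proof (rule eq_vecI)
  fix i assume "i < dim_vec z"
  then have "i < d - 1 \<or> i = d - 1" using assms(2) by auto
  then show "x $ i = z $ i" using assms(3,4) by (auto simp: forget_last_eq_iff)
qed (use assms in auto)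

text \<open>\<open>lowest_point\<close> is a choice by \<open>arg_min\<close>. The assumption
  \<open>ex\<close> supplies a minimum on each fibre, and it is unique since a point of a fibre is
  determined by its last coordinate.\<close>

lemma mem_Omega_iff:
  assumes P: "P \<subseteq> carrier_vec d"
    and ex: "\<And>x. x \<in> P \<Longrightarrow> \<exists>z\<in>P. forget_last d z = forget_last d x \<and>
      (\<forall>y\<in>P. forget_last d y = forget_last d x \<longrightarrow> z $ (d - 1) \<le> y $ (d - 1))"
  shows "x \<in> Omega d P \<longleftrightarrow>
    x \<in> P \<and> (\<exists>z\<in>P. forget_last d z = forget_last d x \<and> z $ (d - 1) < x $ (d - 1))"
proof -
  have low: "lowest_point d (forget_last d z) P = z"
    if "z \<in> P" "\<forall>y\<in>P. forget_last d y = forget_last d z \<longrightarrow> z $ (d - 1) \<le> y $ (d - 1)" for z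
    unfolding lowest_point_def
  proof (rule arg_min_inj_eq)
    show "inj_on (\<lambda>x. x $ (d - 1)) {x. x \<in> P \<and> forget_last d x = forget_last d z}"
    proof (rule inj_onI)
      fix x y
      assume "x \<in> {x. x \<in> P \<and> forget_last d x = forget_last d z}"
        "y \<in> {x. x \<in> P \<and> forget_last d x = forget_last d z}" and xy: "x $ (d - 1) = y $ (d - 1)"
      then have "x \<in> carrier_vec d" "y \<in> carrier_vec d" "forget_last d x = forget_last d y"
        using P by auto
      from this xy show "x = y" by (rule vec_eq_forget_last)
    qed
  qed (use that in auto)
  show ?thesis
  proof
    assume x: "x \<in> Omega d P"
    then have "x \<in> P" "lowest_point d (forget_last d x) P \<noteq> x" by (auto simp: Omega_def)
    then show "x \<in> P \<and> (\<exists>z\<in>P. forget_last d z = forget_last d x \<and> z $ (d - 1) < x $ (d - 1))"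
      using low[of x] by force
  next
    assume x: "x \<in> P \<and> (\<exists>z\<in>P. forget_last d z = forget_last d x \<and> z $ (d - 1) < x $ (d - 1))"
    have "x \<noteq> lowest_point d (forget_last d y) P" if y: "y \<in> P" for y
    proof -
      obtain z where z: "z \<in> P" "forget_last d z = forget_last d y"
        "\<forall>u\<in>P. forget_last d u = forget_last d y \<longrightarrow> z $ (d - 1) \<le> u $ (d - 1)"
        using ex[OF y] by auto
      then have "lowest_point d (forget_last d y) P = z" using low[of z] by simp
      with x z show ?thesis by force
    qed
    with x show "x \<in> Omega d P" by (auto simp: Omega_def)
  qed
qed

lemma P_set_carrier: "P_set d s \<subseteq> carrier_vec d"
  by (auto simp: P_set_def)

lemma R_set_carrier: "R_set d s \<subseteq> carrier_vec d"
  using P_set_carrier by (auto simp: R_set_def Omega_def)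

lemma mem_R_set_iff:
  assumes "d > 0"
  shows "x \<in> R_set d s \<longleftrightarrow> x \<in> P_set d s \<and> 0 < x $ (d - 1)"
proof -
  let ?z = "\<lambda>x. vec d (\<lambda>i. if i = d - 1 then 0 else x $ i)"
  \<comment> \<open>Setting the last coordinate to 0 affects only its own two bounds; the upper one
    stays valid because \<open>x\<close> itself shows that it is nonnegative.\<close>
  have z: "?z x \<in> P_set d s" "forget_last d (?z x) = forget_last d x" "?z x $ (d - 1) = 0"
    if "x \<in> P_set d s" for x
  proof -
    have x: "0 \<le> x $ i" "x $ i \<le> of_int (s i) * (if i = 0 then 1 else x $ (i - 1))" if "i < d" for i
      using \<open>x \<in> P_set d s\<close> that by (auto simp: P_set_def)
    show "?z x \<in> P_set d s"
      unfolding P_set_def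
    proof (intro CollectI conjI allI impI)
      fix i assume i: "i < d"
      then show "0 \<le> ?z x $ i" using x(1) by auto
      show "?z x $ i \<le> of_int (s i) * (if i = 0 then 1 else ?z x $ (i - 1))"
      proof (cases "i = d - 1")
        case True
        then show ?thesis using order_trans[OF x(1,2)[OF i]] i by auto
      next
        case False
        then show ?thesis using x(2)[OF i] i by auto
      qed
    qed simp
    show "forget_last d (?z x) = forget_last d x" by (auto simp: forget_last_eq_iff)
    show "?z x $ (d - 1) = 0" using assms by simp
  qed
  have nonneg: "0 \<le> x $ (d - 1)" if "x \<in> P_set d s" for x
    using that assms by (auto simp: P_set_def)
  have "x \<in> R_set d s \<longleftrightarrow> x \<in> P_set d s \<and>
      (\<exists>z\<in>P_set d s. forget_last d z = forget_last d x \<and> z $ (d - 1) < x $ (d - 1))"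
    unfolding R_set_def
  proof (rule mem_Omega_iff[OF P_set_carrier])
    fix x assume "x \<in> P_set d s"
    with z[OF this] nonneg show "\<exists>z\<in>P_set d s. forget_last d z = forget_last d x \<and>
      (\<forall>y\<in>P_set d s. forget_last d y = forget_last d x \<longrightarrow> z $ (d - 1) \<le> y $ (d - 1))"
      by (intro bexI[of _ "?z x"]) auto
  qed
  also have "\<dots> \<longleftrightarrow> x \<in> P_set d s \<and> 0 < x $ (d - 1)"
    using z[of x] nonneg by (metis order_le_less_trans)
  finally show ?thesis .
qed

section \<open>Barycentric description of the cyclic polytope and of its points that are not
  lowest\<close>

lemma weight_forget_last:
  assumes "d > 0" "forget_last d z = forget_last d x"
  shows "weight d t z j = weight d t x j + coeff (lagrange_basis d t j) d * (z $ (d - 1) - x $ (d - 1))"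
proof -
  obtain n where d: "d = Suc n" using assms(1) by (cases d) auto
  have "(\<Sum>m\<le>n. coeff (lagrange_basis d t j) m * homog z m) =
      (\<Sum>m\<le>n. coeff (lagrange_basis d t j) m * homog x m)"
    using assms(2) d by (intro sum.cong refl) (auto simp: forget_last_eq_iff homog_def)
  then show ?thesis
    by (simp add: weight_def d homog_def algebra_simps)
qed

text \<open>The leading coefficient is the inverse of a product of node differences, of which
  exactly the \<open>d - j\<close> with \<open>k > j\<close> are negative.\<close>

lemma sgn_coeff_lagrange_basis:
  assumes "strict_mono_on {..d} t" "j \<le> d"
  shows "if even (d + j) then coeff (lagrange_basis d t j) d > 0 else coeff (lagrange_basis d t j) d < 0"
proof -
  have lt: "t i < t k" if "i < k" "k \<le> d" for i k
    using strict_mono_onD[OF assms(1), of i k] that by auto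
  define q where "q = (\<Prod>k<j. t j - t k) * (\<Prod>k\<in>{j<..d}. t k - t j)"
  have split: "{..d} - {j} = {..<j} \<union> {j<..d}" using assms(2) by auto
  have "(\<Prod>k\<in>{..d} - {j}. t j - t k) = (\<Prod>k<j. t j - t k) * (\<Prod>k\<in>{j<..d}. t j - t k)"
    unfolding split by (rule prod.union_disjoint) auto
  also have "(\<Prod>k\<in>{j<..d}. t j - t k) = (\<Prod>k\<in>{j<..d}. - (t k - t j))"
    by simp
  also have "\<dots> = (-1) ^ (d - j) * (\<Prod>k\<in>{j<..d}. t k - t j)"
    by (subst prod_uminus) simp
  finally have eq: "(\<Prod>k\<in>{..d} - {j}. t j - t k) = (-1) ^ (d - j) * q"
    by (simp add: q_def)
  have "q > 0"
    unfolding q_def using lt assms(2) by (intro mult_pos_pos prod_pos) auto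
  moreover have "even (d - j) \<longleftrightarrow> even (d + j)" using assms(2) by presburger
  ultimately show ?thesis
    unfolding coeff_lagrange_basis[OF assms(2)] eq by auto
qed

lemma mem_cyclic_polytope_iff:
  assumes "d > 0" "inj_on t {..d}"
  shows "x \<in> cyclic_polytope d (t ` {..d}) \<longleftrightarrow>
    x \<in> carrier_vec d \<and> (\<forall>j\<le>d. 0 \<le> weight d t x j)"
proof -
  let ?\<nu> = "\<lambda>j. moment_curve d (t j)"
  \<comment> \<open>The first coordinate recovers the parameter, so distinct nodes give distinct
    points.\<close>
  have "moment_curve d a $ 0 = a" for a using assms(1) by (simp add: moment_curve_def)
  then have inj: "inj_on ?\<nu> {..d}"
    using assms(2) unfolding inj_on_def by metis
  show ?thesis
  proof
    assume "x \<in> cyclic_polytope d (t ` {..d})"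
    then obtain F c where x: "x = vec d (\<lambda>i. \<Sum>v\<in>F. c v * v $ i)"
      and F: "F \<subseteq> ?\<nu> ` {..d}" "\<forall>v\<in>F. 0 \<le> c v" "sum c F = 1"
      by (auto simp: cyclic_polytope_def conv_def image_image)
    define J where "J = {j\<in>{..d}. ?\<nu> j \<in> F}"
    define w where "w j = (if j \<in> J then c (?\<nu> j) else 0)" for j
    have J: "F = ?\<nu> ` J" "inj_on ?\<nu> J" "J \<subseteq> {..d}"
      using F(1) inj by (auto simp: J_def inj_on_def)
    have sumF: "(\<Sum>v\<in>F. c v * f v) = (\<Sum>j\<le>d. w j * f (?\<nu> j))" for f
    proof -
      have "(\<Sum>v\<in>F. c v * f v) = (\<Sum>j\<in>J. w j * f (?\<nu> j))"
        unfolding J(1) by (simp add: sum.reindex J(2) w_def)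
      also have "\<dots> = (\<Sum>j\<le>d. w j * f (?\<nu> j))"
        using J(3) by (intro sum.mono_neutral_left) (auto simp: w_def)
      finally show ?thesis .
    qed
    have "homog x m = (\<Sum>j\<le>d. w j * t j ^ m)" if "m \<le> d" for m
    proof (cases m)
      case 0
      then show ?thesis using sumF[of "\<lambda>_. 1"] F(3) by (simp add: homog_def)
    next
      case (Suc i)
      then show ?thesis using that sumF[of "\<lambda>v. v $ i"]
        by (simp add: homog_def x moment_curve_def)
    qed
    then have "weight d t x j = w j" if "j \<le> d" for j
      using weight_unique[OF assms(2) that] by simp
    moreover have "0 \<le> w j" for j
      using F(2) J(1) by (auto simp: w_def)
    ultimately show "x \<in> carrier_vec d \<and> (\<forall>j\<le>d. 0 \<le> weight d t x j)"
      by (simp add: x)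
  next
    assume x: "x \<in> carrier_vec d \<and> (\<forall>j\<le>d. 0 \<le> weight d t x j)"
    define c where "c v = weight d t x (the_inv_into {..d} ?\<nu> v)" for v
    have c: "c (?\<nu> j) = weight d t x j" if "j \<le> d" for j
      using the_inv_into_f_f[OF inj] that by (simp add: c_def)
    have sums: "(\<Sum>v\<in>?\<nu> ` {..d}. c v * f v) = (\<Sum>j\<le>d. weight d t x j * f (?\<nu> j))" for f
      by (simp add: sum.reindex[OF inj] c)
    have "x = vec d (\<lambda>i. \<Sum>v\<in>?\<nu> ` {..d}. c v * v $ i)"
    proof (rule eq_vecI)
      fix i assume "i < dim_vec (vec d (\<lambda>i. \<Sum>v\<in>?\<nu> ` {..d}. c v * v $ i))"
      then have "i < d" by simp
      then have "(\<Sum>v\<in>?\<nu> ` {..d}. c v * v $ i) = (\<Sum>j\<le>d. weight d t x j * t j ^ Suc i)"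
        unfolding sums[of "\<lambda>v. v $ i"] by (intro sum.cong refl) (simp add: moment_curve_def)
      then show "x $ i = vec d (\<lambda>i. \<Sum>v\<in>?\<nu> ` {..d}. c v * v $ i) $ i"
        using sum_weight_power[OF assms(2), of "Suc i" x] \<open>i < d\<close> by (simp add: homog_def)
    qed (use x in auto)
    moreover have "sum c (?\<nu> ` {..d}) = 1"
      using sums[of "\<lambda>_. 1"] sum_weight_power[OF assms(2), of 0 x] by (simp add: homog_def)
    moreover have "\<forall>v\<in>?\<nu> ` {..d}. 0 \<le> c v" using x c by auto
    ultimately show "x \<in> cyclic_polytope d (t ` {..d})"
      unfolding cyclic_polytope_def conv_def image_image
      by (intro CollectI exI[of _ "?\<nu> ` {..d}"] exI[of _ c]) auto
  qed
qed

lemma mem_Omega_cyclic_polytope_iff: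
  assumes d: "d > 0" and t: "strict_mono_on {..d} t"
  shows "x \<in> Omega d (cyclic_polytope d (t ` {..d})) \<longleftrightarrow>
    x \<in> carrier_vec d \<and> (\<forall>j\<le>d. if even (d + j) then 0 < weight d t x j else 0 \<le> weight d t x j)"
proof -
  let ?C = "cyclic_polytope d (t ` {..d})"
  let ?E = "{j. j \<le> d \<and> even (d + j)}"
  let ?k = "\<lambda>j. coeff (lagrange_basis d t j) d"
  let ?w = "weight d t"
  define down where "down \<epsilon> x = vec d (\<lambda>i. if i = d - 1 then x $ i - \<epsilon> else x $ i)" for \<epsilon> and x :: "real vec"
  have memC: "x \<in> ?C \<longleftrightarrow> x \<in> carrier_vec d \<and> (\<forall>j\<le>d. 0 \<le> ?w x j)" for x
    by (rule mem_cyclic_polytope_iff[OF d strict_mono_on_imp_inj_on[OF t]])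
  have k_pos: "0 < ?k j" if "j \<in> ?E" for j
    using sgn_coeff_lagrange_basis[OF t, of j] that by auto
  have k_neg: "?k j < 0" if "j \<le> d" "j \<notin> ?E" for j
    using sgn_coeff_lagrange_basis[OF t, of j] that by auto
  \<comment> \<open>A zero weight with positive rate becomes negative on any descent, so such a
    point is lowest in its fibre.\<close>
  have low: "z $ (d - 1) \<le> y $ (d - 1)"
    if "j \<in> ?E" "?w z j = 0" "y \<in> ?C" "forget_last d y = forget_last d z" for j y z
  proof -
    have "0 \<le> ?k j * (y $ (d - 1) - z $ (d - 1))"
      using weight_forget_last[OF d that(4), of t j] that memC by auto
    then show ?thesis using k_pos[OF that(1)] by (simp add: zero_le_mult_iff)
  qed
  have fl: "forget_last d (down \<epsilon> x) = forget_last d x" and last: "down \<epsilon> x $ (d - 1) = x $ (d - 1) - \<epsilon>" for \<epsilon> x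
    using d by (auto simp: down_def forget_last_eq_iff)
  have wd: "?w (down \<epsilon> x) j = ?w x j - ?k j * \<epsilon>" for \<epsilon> x j
    using weight_forget_last[OF d fl, of t \<epsilon> x j] last by simp
  \<comment> \<open>the largest distance by which \<open>x\<close> can be lowered inside the polytope\<close>
  define \<epsilon> where "\<epsilon> x = Min ((\<lambda>j. ?w x j / ?k j) ` ?E)" for x
  have E: "finite ?E" "d \<in> ?E" by auto
  have \<epsilon>_le: "?k j * \<epsilon> x \<le> ?w x j" if "j \<in> ?E" for j x
  proof -
    have "\<epsilon> x \<le> ?w x j / ?k j" unfolding \<epsilon>_def using E that by (intro Min_le) auto
    then show ?thesis using k_pos[OF that] by (simp add: field_simps)
  qed
  have \<epsilon>_eq: "\<exists>j\<in>?E. ?w x j = ?k j * \<epsilon> x" for x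
  proof -
    have "\<epsilon> x \<in> (\<lambda>j. ?w x j / ?k j) ` ?E" unfolding \<epsilon>_def using E by (intro Min_in) auto
    then obtain j where "j \<in> ?E" "\<epsilon> x = ?w x j / ?k j" by auto
    with k_pos[of j] show ?thesis by (intro bexI[of _ j]) auto
  qed
  \<comment> \<open>Lowering by \<open>\<epsilon> x\<close> keeps the weights in \<open>?E\<close>
    nonnegative by the choice of the minimum, and the others because they grow, as
    \<open>\<epsilon> x\<close> is nonnegative.\<close>
  have down: "down (\<epsilon> x) x \<in> ?C" if "x \<in> ?C" for x
  proof -
    obtain j where j: "j \<in> ?E" "?w x j = ?k j * \<epsilon> x" using \<epsilon>_eq by blast
    then have "0 \<le> ?k j * \<epsilon> x" using that memC by auto
    then have "0 \<le> \<epsilon> x" using k_pos[OF j(1)] by (simp add: zero_le_mult_iff)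
    then have "?k i * \<epsilon> x \<le> ?w x i" if "i \<le> d" for i
      using \<epsilon>_le[of i x] k_neg[OF that] \<open>x \<in> ?C\<close> memC[of x] that
      by (cases "i \<in> ?E") (auto intro: order_trans[OF mult_nonpos_nonneg])
    then show ?thesis by (simp add: memC wd) (simp add: down_def)
  qed
  have zero: "\<exists>j\<in>?E. ?w (down (\<epsilon> x) x) j = 0" for x
    using \<epsilon>_eq[of x] by (simp add: wd)
  have "x \<in> Omega d ?C \<longleftrightarrow>
    x \<in> ?C \<and> (\<exists>z\<in>?C. forget_last d z = forget_last d x \<and> z $ (d - 1) < x $ (d - 1))"
  proof (rule mem_Omega_iff)
    show "?C \<subseteq> carrier_vec d" using memC by auto
    fix x assume x: "x \<in> ?C"
    obtain j where "j \<in> ?E" "?w (down (\<epsilon> x) x) j = 0" using zero by blast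
    note low[OF this]
    then show "\<exists>z\<in>?C. forget_last d z = forget_last d x \<and>
      (\<forall>y\<in>?C. forget_last d y = forget_last d x \<longrightarrow> z $ (d - 1) \<le> y $ (d - 1))"
      using down[OF x] by (intro bexI[of _ "down (\<epsilon> x) x"]) (auto simp: fl)
  qed
  also have "\<dots> \<longleftrightarrow> x \<in> ?C \<and> (\<forall>j\<in>?E. 0 < ?w x j)"
  proof (intro conj_cong refl iffI ballI)
    fix j assume x: "x \<in> ?C" and j: "j \<in> ?E"
      and "\<exists>z\<in>?C. forget_last d z = forget_last d x \<and> z $ (d - 1) < x $ (d - 1)"
    then have "?w x j \<noteq> 0" using low[OF j] by force
    then show "0 < ?w x j" using x j memC by (auto simp: order_less_le)
  next
    assume x: "x \<in> ?C" and pos: "\<forall>j\<in>?E. 0 < ?w x j"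
    obtain j where "j \<in> ?E" "?w x j = ?k j * \<epsilon> x" using \<epsilon>_eq by blast
    with pos k_pos have "0 < \<epsilon> x" by (metis zero_less_mult_pos)
    with down[OF x] last[of "\<epsilon> x" x]
    show "\<exists>z\<in>?C. forget_last d z = forget_last d x \<and> z $ (d - 1) < x $ (d - 1)"
      by (intro bexI[of _ "down (\<epsilon> x) x"]) (auto simp: fl)
  qed
  also have "\<dots> \<longleftrightarrow> x \<in> carrier_vec d \<and>
      (\<forall>j\<le>d. if even (d + j) then 0 < ?w x j else 0 \<le> ?w x j)"
    unfolding memC by (auto intro: less_imp_le)
  finally show ?thesis .
qed

section \<open>Membership in a single term, and the final comparison\<close>

lemma mem_phi_inv_R_set_iff:
  fixes t :: "nat \<Rightarrow> int"
  assumes d: "d > 0" and t: "strict_mono_on {..d} t" and \<sigma>: "\<sigma> permutes {..<d}" and x: "x \<in> carrier_vec d"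
  defines "w \<equiv> weight d (\<lambda>j. real_of_int (t j)) x"
  shows "x \<in> phi_inv d (\<lambda>i. real_of_int (t (\<sigma> i))) ` R_set d (\<lambda>i. t d - t (\<sigma> i)) \<longleftrightarrow>
    0 < w d \<and> flag_nonneg d (\<lambda>j. real_of_int (t j)) (\<lambda>j. w j * (real_of_int (t d) - real_of_int (t j))) \<sigma>"
proof -
  let ?t = "\<lambda>j. real_of_int (t j)"
  let ?r = "\<lambda>i. ?t (\<sigma> i)"
  \<comment> \<open>\<open>Y 0, \<dots>, Y d\<close> are the coordinates of the image under
    \<open>phi\<close>, with the conventional leading 1 at index 0.\<close>
  define Y where "Y i = (\<Sum>j\<le>d. w j * (\<Prod>k<i. ?t j - ?r k))" for i
  have lt: "?t i < ?t d" if "i < d" for i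
    using strict_mono_onD[OF t, of i d] that by auto
  have \<sigma>_lt: "\<sigma> i < d" if "i < d" for i
    using permutes_in_image[OF \<sigma>, of i] that by auto
  have inj: "inj_on ?t {..d}"
    using strict_mono_on_imp_inj_on[OF t] by (auto simp: inj_on_def)
  have phi: "phi d ?r x $ i = Y (Suc i)" if "i < d" for i
    unfolding Y_def w_def by (rule phi_index_weight[OF inj x that])
  have Y0: "Y 0 = 1"
    using sum_weight_power[OF inj, of 0 x] by (simp add: Y_def w_def homog_def)
  \<comment> \<open>The factors \<open>?t d - ?r i\<close> and \<open>?t j - ?r i\<close> differ by
    \<open>?t d - ?t j\<close>, which vanishes at \<open>j = d\<close>.\<close>
  have step: "(?t d - ?r i) * Y i - Y (Suc i) = (\<Sum>j<d. w j * (?t d - ?t j) * (\<Prod>k<i. ?t j - ?r k))" for i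
  proof -
    have "(?t d - ?r i) * Y i - Y (Suc i) = (\<Sum>j\<le>d. w j * (?t d - ?t j) * (\<Prod>k<i. ?t j - ?r k))"
      unfolding Y_def sum_distrib_left sum_subtractf[symmetric]
      by (intro sum.cong refl) (simp add: algebra_simps)
    also have "\<dots> = (\<Sum>j<d. w j * (?t d - ?t j) * (\<Prod>k<i. ?t j - ?r k))"
      by (simp flip: lessThan_Suc_atMost)
    finally show ?thesis .
  qed
  \<comment> \<open>Every \<open>j < d\<close> is some \<open>\<sigma> k\<close>, so its full
    product contains a zero factor and only \<open>j = d\<close> survives.\<close>
  have "Y d = (\<Sum>j\<le>d. if j = d then w d * (\<Prod>k<d. ?t d - ?r k) else 0)"
    unfolding Y_def
  proof (intro sum.cong refl)
    fix j assume "j \<in> {..d}"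
    moreover have "(\<Prod>k<d. ?t j - ?r k) = 0" if "j < d"
      using that permutes_surj[OF \<sigma>] permutes_in_image[OF \<sigma>]
      by (intro prod_zero) (auto, metis lessThan_iff surjD)
    ultimately show "w j * (\<Prod>k<d. ?t j - ?r k) = (if j = d then w d * (\<Prod>k<d. ?t d - ?r k) else 0)"
      by auto
  qed
  then have "Y d = w d * (\<Prod>k<d. ?t d - ?r k)" by simp
  moreover have "(\<Prod>k<d. ?t d - ?r k) > 0"
    using lt \<sigma>_lt by (intro prod_pos) auto
  ultimately have Yd: "0 < Y d \<longleftrightarrow> 0 < w d" by (simp add: zero_less_mult_iff)
  have flag: "flag_nonneg d ?t (\<lambda>j. w j * (?t d - ?t j)) \<sigma> \<longleftrightarrow> (\<forall>i<d. Y (Suc i) \<le> (?t d - ?r i) * Y i)"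
    unfolding flag_nonneg_def step[symmetric] by simp
  have "x \<in> phi_inv d ?r ` R_set d (\<lambda>i. t d - t (\<sigma> i)) \<longleftrightarrow>
    (\<forall>i<d. 0 \<le> Y (Suc i) \<and> Y (Suc i) \<le> (?t d - ?r i) * Y i) \<and> 0 < Y d"
  proof -
    have Y: "(if i = 0 then 1 else phi d ?r x $ (i - 1)) = Y i" if "i < d" for i
      using phi[of "i - 1"] that by (auto simp: Y0)
    show ?thesis
      unfolding mem_phi_inv_image_iff[OF R_set_carrier] mem_R_set_iff[OF d]
      using d x phi[of "d - 1"] by (auto simp: P_set_def phi_carrier phi Y)
  qed
  also have "\<dots> \<longleftrightarrow> (\<forall>i<d. Y (Suc i) \<le> (?t d - ?r i) * Y i) \<and> 0 < Y d"
  proof -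
    \<comment> \<open>Positivity spreads downwards from \<open>Y d\<close>, since each upper bound
      multiplies \<open>Y i\<close> by a positive number. Hence the lower bounds of
      \<open>P_set\<close> follow.\<close>
    have "0 < Y i" if le: "\<And>i. i < d \<Longrightarrow> Y (Suc i) \<le> (?t d - ?r i) * Y i" and "0 < Y d" "i \<le> d" for i
      using \<open>i \<le> d\<close>
    proof (induction rule: inc_induct)
      case (step i)
      then have "0 < (?t d - ?r i) * Y i" using le[of i] by simp
      then show ?case using lt[OF \<sigma>_lt, of i] step.hyps by (simp add: zero_less_mult_iff)
    qed (rule \<open>0 < Y d\<close>)
    then show ?thesis by (auto intro: less_imp_le Suc_leI)
  qed
  finally show ?thesis using flag Yd by auto
qed

theorem theorem2p18:
  fixes d :: nat and T :: "int set" and t :: "nat \<Rightarrow> int"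
  assumes "d > 0"
    and "T = t ` {..d}"
    and "strict_mono_on {..d} t"
  shows "set_as_mset (Omega d (cyclic_polytope d (real_of_int ` T))) =
    (\<lambda>x. \<Sum>\<sigma> | \<sigma> permutes {..<d}. sign \<sigma> *
       set_as_mset (phi_inv d (\<lambda>i. real_of_int (t (\<sigma> i))) ` R_set d (\<lambda>i. t d - t (\<sigma> i))) x)"
proof
  fix x
  let ?t = "\<lambda>j. real_of_int (t j)"
  let ?R = "\<lambda>\<sigma>. phi_inv d (\<lambda>i. ?t (\<sigma> i)) ` R_set d (\<lambda>i. t d - t (\<sigma> i))"
  have t: "strict_mono_on {..d} ?t"
    using assms(3) by (simp add: strict_mono_on_def)
  have T: "real_of_int ` T = ?t ` {..d}" by (simp add: assms(2) image_image)
  note Omega = mem_Omega_cyclic_polytope_iff[OF assms(1) t, of x, folded T]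
  show "set_as_mset (Omega d (cyclic_polytope d (real_of_int ` T))) x =
    (\<Sum>\<sigma> | \<sigma> permutes {..<d}. sign \<sigma> * set_as_mset (?R \<sigma>) x)"
  proof (cases "x \<in> carrier_vec d")
    case False
    then show ?thesis
      by (simp add: indicator_def Omega mem_phi_inv_image_iff[OF R_set_carrier])
  next
    case True
    define w where "w = weight d ?t x"
    let ?v = "\<lambda>j. w j * (?t d - ?t j)"
    have "(\<Sum>\<sigma> | \<sigma> permutes {..<d}. sign \<sigma> * set_as_mset (?R \<sigma>) x) =
      of_bool (0 < w d) * (\<Sum>\<sigma> | \<sigma> permutes {..<d}. sign \<sigma> * of_bool (flag_nonneg d ?t ?v \<sigma>))"
      unfolding sum_distrib_left
      by (intro sum.cong refl)
        (simp add: indicator_def w_def mem_phi_inv_R_set_iff[OF assms(1,3) _ True])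
    also have "\<dots> = of_bool (0 < w d) * of_bool (\<forall>j<d. alt_nonneg d j (?v j))"
      by (subst sum_sign_flag_nonneg)
        (use t in \<open>auto simp: strict_mono_on_def\<close>)
    \<comment> \<open>Since \<open>?t d - ?t j\<close> is positive for \<open>j < d\<close>,
      \<open>?v j\<close> and \<open>w j\<close> have the same sign; the separate factor
      \<open>0 < w d\<close> is the condition at \<open>j = d\<close>.\<close>
    also have "\<dots> = of_bool (\<forall>j\<le>d. if even (d + j) then 0 < w j else 0 \<le> w j)"
    proof -
      have "alt_nonneg d j (?v j) \<longleftrightarrow> (if even (d + j) then 0 < w j else 0 \<le> w j)" if "j < d" for j
        using strict_mono_onD[OF t, of j d] that
        by (auto simp: alt_nonneg_def zero_le_mult_iff zero_less_mult_iff)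
      then show ?thesis by (auto simp: le_less)
    qed
    also have "\<dots> = set_as_mset (Omega d (cyclic_polytope d (real_of_int ` T))) x"
      using True by (simp add: indicator_def Omega w_def)
    finally show ?thesis by simp
  qed
qed

end
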